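(* Let ${\bf n}'=n'_1n'_2\cdots$ be the fixed point of $0\mapsto01$, $1\mapsto2$, $2\mapsto0$ starting with $0$, indexed from $1$. Let $i\in\{0,1,2\}$. Then a positive integer $k$ satisfies $n'_k=i$ if and only if there exists $s\ge0$ such that the Narayana representation $(k)_N$ ends in a $1$ followed by exactly $3s+i$ zeros.
   Context: Narayana numbers: $N_0=1,N_1=2,N_2=3$, $N_i=N_{i-1}+N_{i-3}$ for $i\ge3$. The Narayana representation $(k)_N$ of a positive integer $k$ is the unique binary word $e_1\cdots e_t$ with $e_1=1$, no factor $11$ or $101$, and $k=\sum_{i=1}^te_iN_{t-i}$. *)

theory Defs
  imports "HOL-Library.Stream" "HOL-Library.Sublist"
begin

fun narayana :: "nat \<Rightarrow> nat" where
  "narayana 0 = 1"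
| "narayana (Suc 0) = 2"
| "narayana (Suc (Suc 0)) = 3"
| "narayana (Suc (Suc (Suc n))) = narayana (Suc (Suc n)) + narayana n"

definition is_narayana_rep :: "nat list \<Rightarrow> nat \<Rightarrow> bool" where
  "is_narayana_rep e k \<longleftrightarrow>
     set e \<subseteq> {0, 1} \<and> e \<noteq> [] \<and> hd e = 1 \<and>
     \<not> sublist [1, 1] e \<and> \<not> sublist [1, 0, 1] e \<and>
     k = (\<Sum>i = 1..length e. e ! (i - 1) * narayana (length e - i))"

definition narayana_rep :: "nat \<Rightarrow> nat list" where
  "narayana_rep k = (THE e. is_narayana_rep e k)"

text \<open>Letters are the numbers 0, 1, 2; the value of the morphism at any other number is irrelevant.\<close>

definition narayana_morphism :: "nat \<Rightarrow> nat list" where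
  "narayana_morphism a = (if a = 0 then [0, 1] else if a = 1 then [2] else [0])"

definition is_narayana_fixed_point :: "nat stream \<Rightarrow> bool" where
  "is_narayana_fixed_point w \<longleftrightarrow>
     w \<in> streams {0, 1, 2} \<and> shd w = 0 \<and> flat (smap narayana_morphism w) = w"

text \<open>Streams are indexed from 0, so the letter at position \<open>k \<ge> 1\<close> of the
  infinite word indexed from 1 is \<open>narayana_word !! (k - 1)\<close>.\<close>

definition narayana_word :: "nat stream" where
  "narayana_word = (THE w. is_narayana_fixed_point w)"


subsection \<open>Both definite descriptions are well defined\<close>

lemma narayana_pos: "0 < narayana n"
  by (induction n rule: narayana.induct) auto

lemma narayana_strict_mono: "strict_mono narayana"
  unfolding strict_mono_Suc_iff
proof
  fix n show "narayana n < narayana (Suc n)"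
    by (induction n rule: narayana.induct) (auto simp: narayana_pos)
qed

definition narayana_val :: "nat list \<Rightarrow> nat" where
  "narayana_val e = (\<Sum>i = 1..length e. e ! (i - 1) * narayana (length e - i))"

definition narayana_admissible :: "nat list \<Rightarrow> bool" where
  "narayana_admissible e \<longleftrightarrow>
     set e \<subseteq> {0, 1} \<and> \<not> sublist [1, 1] e \<and> \<not> sublist [1, 0, 1] e"

lemma narayana_val_Nil [simp]: "narayana_val [] = 0"
  by (simp add: narayana_val_def)

lemma narayana_val_Cons [simp]:
  "narayana_val (x # xs) = x * narayana (length xs) + narayana_val xs"
proof -
  have "(\<Sum>i = Suc 1..Suc (length xs). (x # xs) ! (i - 1) * narayana (length (x # xs) - i))
      = (\<Sum>i = 1..length xs. xs ! (i - 1) * narayana (length xs - i))"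
    unfolding sum.shift_bounds_cl_Suc_ivl
    by (intro sum.cong) (auto simp: nth_Cons')
  then show ?thesis
    unfolding narayana_val_def by (subst sum.atLeast_Suc_atMost) (simp_all del: sum.cl_ivl_Suc)
qed

lemma admissible_Nil [simp]: "narayana_admissible []"
  by (simp add: narayana_admissible_def)

lemma admissible_0 [simp]: "narayana_admissible (0 # e) \<longleftrightarrow> narayana_admissible e"
  by (auto simp: narayana_admissible_def sublist_Cons_right)

lemma admissible_1:
  "narayana_admissible (Suc 0 # e) \<longleftrightarrow>
     e = [] \<or> e = [0] \<or> (\<exists>e'. e = 0 # 0 # e' \<and> narayana_admissible e')"
proof (cases e)
  case (Cons a f)
  then show ?thesis
    by (cases f) (auto simp: narayana_admissible_def sublist_Cons_right)
qed (auto simp: narayana_admissible_def sublist_Cons_right)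

lemma admissible_Cons_cases:
  assumes "narayana_admissible (x # e)"
  shows "narayana_admissible e \<and> (x = 0 \<or> x = Suc 0)"
  using assms by (auto simp: narayana_admissible_def sublist_Cons_right)

lemma narayana_val_less: "narayana_admissible e \<Longrightarrow> narayana_val e < narayana (length e)"
proof (induction "length e" arbitrary: e rule: less_induct)
  case less
  show ?case
  proof (cases e)
    case (Cons x f)
    from less.prems Cons have f: "narayana_admissible f" "x = 0 \<or> x = Suc 0"
      using admissible_Cons_cases by auto
    have IH: "narayana_val f < narayana (length f)"
      using less.hyps f Cons by simp
    have mono: "narayana (length f) < narayana (Suc (length f))"
      using narayana_strict_mono by (simp add: strict_mono_Suc_iff)
    show ?thesis
    proof (cases "x = 0")
      case True
      then show ?thesis using Cons IH mono by simp
    next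
      case False
      then have "f = [] \<or> f = [0] \<or> (\<exists>e'. f = 0 # 0 # e' \<and> narayana_admissible e')"
        using less.prems Cons f admissible_1 by auto
      then show ?thesis
        using Cons False f(2) less.hyps by auto
    qed
  qed auto
qed

lemma narayana_val_inj:
  assumes "length e = length f" "narayana_admissible e" "narayana_admissible f"
    "narayana_val e = narayana_val f"
  shows "e = f"
  using assms
proof (induction e f rule: list_induct2)
  case (Cons x xs y ys)
  have "narayana_admissible xs" "narayana_admissible ys" "x = 0 \<or> x = Suc 0" "y = 0 \<or> y = Suc 0"
    using Cons.prems admissible_Cons_cases by blast+
  moreover from this have "narayana_val xs < narayana (length xs)" "narayana_val ys < narayana (length ys)"
    using narayana_val_less by auto
  ultimately show ?case
    using Cons by auto
qed auto

lemma narayana_val_surj: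
  "k < narayana n \<Longrightarrow> \<exists>e. length e = n \<and> narayana_admissible e \<and> narayana_val e = k"
proof (induction n arbitrary: k rule: less_induct)
  case (less n)
  show ?case
  proof (cases n)
    case 0
    then show ?thesis using less.prems by auto
  next
    case (Suc m)
    show ?thesis
    proof (cases "k < narayana m")
      case True
      then obtain e where "length e = m" "narayana_admissible e" "narayana_val e = k"
        using less.IH Suc by blast
      then show ?thesis using Suc by (intro exI[of _ "0 # e"]) simp
    next
      case False
      consider "m = 0" | "m = Suc 0" | p where "m = Suc (Suc p)"
        by (metis not0_implies_Suc)
      then show ?thesis
      proof cases
        case 1
        then show ?thesis using Suc False less.prems
          by (intro exI[of _ "[Suc 0]"]) (simp add: admissible_1)
      next
        case 2
        then show ?thesis using Suc False less.prems
          by (intro exI[of _ "[Suc 0, 0]"]) (simp add: admissible_1)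
      next
        case 3
        then have "k - narayana m < narayana p" using Suc False less.prems by simp
        then obtain e where "length e = p" "narayana_admissible e" "narayana_val e = k - narayana m"
          using less.IH[of p] Suc 3 by auto
        then show ?thesis using Suc 3 False
          by (intro exI[of _ "Suc 0 # 0 # 0 # e"]) (simp add: admissible_1)
      qed
    qed
  qed
qed

lemma is_narayana_rep_iff:
  "is_narayana_rep e k \<longleftrightarrow> narayana_admissible e \<and> narayana_val e = k \<and> (\<exists>f. e = 1 # f)"
  by (cases e) (auto simp: is_narayana_rep_def narayana_admissible_def narayana_val_def)

lemma narayana_rep_length:
  assumes "is_narayana_rep e k"
  shows "0 < length e" "narayana (length e - 1) \<le> k" "k < narayana (length e)"
  using assms narayana_val_less by (auto simp: is_narayana_rep_iff)

lemma narayana_rep_ex1: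
  assumes "0 < k"
  shows "\<exists>!e. is_narayana_rep e k"
proof (rule ex_ex1I)
  have "Suc k \<le> narayana (Suc k)"
    by (rule strict_mono_imp_increasing[OF narayana_strict_mono])
  then have k: "k < narayana (Suc k)" by simp
  define n where "n = (LEAST n. k < narayana n)"
  have n: "k < narayana n"
    unfolding n_def using k by (rule LeastI)
  then obtain m where m: "n = Suc m"
    using assms by (cases n) auto
  then have le: "narayana m \<le> k"
    unfolding n_def using not_less_Least by (metis lessI not_le)
  obtain e where e: "length e = n" "narayana_admissible e" "narayana_val e = k"
    using narayana_val_surj n by blast
  then obtain x f where xf: "e = x # f" "length f = m"
    using m by (cases e) auto
  have "x = Suc 0"
  proof (rule ccontr)
    assume "x \<noteq> Suc 0"
    then have "x = 0" "narayana_admissible f"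
      using e xf admissible_Cons_cases by blast+
    then show False
      using narayana_val_less[of f] e xf le by simp
  qed
  then show "\<exists>e. is_narayana_rep e k"
    using e xf by (auto simp: is_narayana_rep_iff)
next
  fix e f assume ef: "is_narayana_rep e k" "is_narayana_rep f k"
  have "narayana (length e - 1) < narayana (length f)" "narayana (length f - 1) < narayana (length e)"
    using narayana_rep_length[OF ef(1)] narayana_rep_length[OF ef(2)] by linarith+
  then have "length e = length f"
    using narayana_rep_length(1)[OF ef(1)] narayana_rep_length(1)[OF ef(2)]
    by (simp add: strict_mono_less[OF narayana_strict_mono])
  then show "e = f"
    using ef narayana_val_inj by (auto simp: is_narayana_rep_iff)
qed

lemma is_narayana_rep_narayana_rep: "0 < k \<Longrightarrow> is_narayana_rep (narayana_rep k) k"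
  unfolding narayana_rep_def by (rule theI') (rule narayana_rep_ex1)

text \<open>The queue \<open>q\<close> holds the letters produced but not yet emitted.\<close>

primcorec narayana_gen :: "nat list \<Rightarrow> nat stream" where
  "shd (narayana_gen q) = hd q"
| "stl (narayana_gen q) = narayana_gen (tl q @ narayana_morphism (hd q))"

lemma narayana_morphism_nonempty [simp]: "narayana_morphism a \<noteq> []"
  by (simp add: narayana_morphism_def)

lemma narayana_flat_unfold:
  "flat (smap narayana_morphism s) =
     narayana_morphism (shd s) @- flat (smap narayana_morphism (stl s))"
  by (subst stream.collapse[of s, symmetric]) (simp del: stream.collapse)

lemma narayana_gen_eq:
  "q \<noteq> [] \<Longrightarrow> narayana_gen q = q @- flat (smap narayana_morphism (narayana_gen q))"
proof (coinduction arbitrary: q rule: stream.coinduct_strong)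
  case (Eq_stream q)
  have "stl (q @- flat (smap narayana_morphism (narayana_gen q)))
    = (tl q @ narayana_morphism (hd q)) @-
        flat (smap narayana_morphism (narayana_gen (tl q @ narayana_morphism (hd q))))"
    using Eq_stream by (subst narayana_flat_unfold) simp
  moreover have "tl q @ narayana_morphism (hd q) \<noteq> []" by simp
  ultimately show ?case
    using Eq_stream by (metis narayana_gen.sel shift_simps(1))
qed

lemma narayana_gen_unique:
  "q \<noteq> [] \<Longrightarrow> s = q @- flat (smap narayana_morphism s) \<Longrightarrow> s = narayana_gen q"
proof (coinduction arbitrary: q s rule: stream.coinduct_strong)
  case (Eq_stream q s)
  have hd: "shd s = hd q"
    using Eq_stream by (metis shift_simps(1))
  have "stl s = tl q @- flat (smap narayana_morphism s)"
    using Eq_stream by (metis shift_simps(2))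
  then have "stl s = (tl q @ narayana_morphism (hd q)) @- flat (smap narayana_morphism (stl s))"
    using narayana_flat_unfold[of s] by (simp add: hd)
  moreover have "tl q @ narayana_morphism (hd q) \<noteq> []" by simp
  ultimately show ?case
    using hd by (metis narayana_gen.sel)
qed

lemma narayana_gen_streams:
  "q \<noteq> [] \<Longrightarrow> set q \<subseteq> {0, 1, 2} \<Longrightarrow> narayana_gen q \<in> streams {0, 1, 2}"
proof (coinduction arbitrary: q rule: streams.coinduct)
  case (streams q)
  have "hd q \<in> {0, 1, 2}" using streams by (meson hd_in_set subsetD)
  moreover have "set (tl q @ narayana_morphism (hd q)) \<subseteq> {0, 1, 2}"
    using streams by (auto simp: narayana_morphism_def dest: list.set_sel(2))
  moreover have "narayana_gen q = hd q ## narayana_gen (tl q @ narayana_morphism (hd q))"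
    by (rule narayana_gen.code)
  ultimately show ?case
    by (metis append_is_Nil_conv narayana_morphism_nonempty)
qed

lemma narayana_fixed_point_ex1: "\<exists>!w. is_narayana_fixed_point w"
proof (rule ex1I)
  have "narayana_gen [1] = [1] @- flat (smap narayana_morphism (narayana_gen [1]))"
    by (rule narayana_gen_eq) simp
  moreover have "narayana_gen [1] \<in> streams {0, 1, 2}"
    by (rule narayana_gen_streams) auto
  ultimately show "is_narayana_fixed_point (0 ## narayana_gen [1])"
    unfolding is_narayana_fixed_point_def
    by (subst narayana_flat_unfold) (auto simp: narayana_morphism_def streams_Stream)
next
  fix w assume w: "is_narayana_fixed_point w"
  then have "w = [0, 1] @- flat (smap narayana_morphism (stl w))"
    unfolding is_narayana_fixed_point_def
    by (metis narayana_flat_unfold narayana_morphism_def)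
  then have "stl w = [1] @- flat (smap narayana_morphism (stl w))"
    by (metis shift_simps(2) list.sel(3) list.distinct(1))
  then have "stl w = narayana_gen [1]"
    by (rule narayana_gen_unique[rotated]) simp
  then show "w = 0 ## narayana_gen [1]"
    using w unfolding is_narayana_fixed_point_def by (metis stream.collapse)
qed

lemma is_narayana_fixed_point_narayana_word: "is_narayana_fixed_point narayana_word"
  unfolding narayana_word_def by (rule theI') (rule narayana_fixed_point_ex1)

end

theory Submission imports Defs begin

text \<open>
  Let \<open>h\<close> be the morphism. Since \<open>h\<^sup>2(1) = 0\<close>, the prefixes \<open>P n = h\<^sup>n(0)\<close> of the fixed point
  satisfy \<open>P (n + 3) = P (n + 2) P n\<close>, so \<open>P n\<close> has length \<open>N\<^sub>n\<close> and ends in the letter \<open>n mod 3\<close>.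
  Hence the letters at positions \<open>N\<^sub>m\<^sub>+\<^sub>2 + r\<close> and \<open>r\<close> agree for \<open>1 \<le> r \<le> N\<^sub>m\<close>. Removing the
  leading \<open>1\<close> of a Narayana representation therefore does not change the letter, as long as another
  \<open>1\<close> remains; the last remaining \<open>1\<close>, followed by \<open>n\<close> zeros, denotes \<open>N\<^sub>n\<close>.
\<close>

text \<open>Using the recurrence of \<open>narayana\<close> here, rather than iterating the
  morphism, makes the length and the last letter direct inductions.\<close>

fun narayana_prefix :: "nat \<Rightarrow> nat list" where
  "narayana_prefix 0 = [0]"
| "narayana_prefix (Suc 0) = [0, 1]"
| "narayana_prefix (Suc (Suc 0)) = [0, 1, 2]"
| "narayana_prefix (Suc (Suc (Suc n))) = narayana_prefix (Suc (Suc n)) @ narayana_prefix n"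

lemma length_narayana_prefix [simp]: "length (narayana_prefix n) = narayana n"
  by (induction n rule: narayana_prefix.induct) auto

lemma narayana_prefix_nonempty [simp]: "narayana_prefix n \<noteq> []"
  using length_narayana_prefix[of n] narayana_pos[of n] by (metis length_0_conv less_irrefl)

lemma last_narayana_prefix: "last (narayana_prefix n) = n mod 3"
proof (induction n rule: narayana_prefix.induct)
  case (4 n)
  then show ?case using mod_add_self2[of n 3] by simp
qed simp_all

text \<open>The morphism distributes over concatenation, so it respects the recurrence; the base
  case 012 is sent to 0120.\<close>

lemma morphism_narayana_prefix:
  "concat (map narayana_morphism (narayana_prefix n)) = narayana_prefix (Suc n)"
  by (induction n rule: narayana_prefix.induct) (simp_all add: narayana_morphism_def)

lemma flat_smap_morphism_shift:
  "flat (smap narayana_morphism (xs @- s)) =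
     concat (map narayana_morphism xs) @- flat (smap narayana_morphism s)"
proof (induction xs)
  case (Cons x xs)
  then show ?case
    using narayana_flat_unfold[of "x ## (xs @- s)"] by simp
qed simp

lemma narayana_word_eq_prefix_shift: "\<exists>s. narayana_word = narayana_prefix n @- s"
proof (induction n)
  case 0
  have "narayana_word = [0] @- stl narayana_word"
    using is_narayana_fixed_point_narayana_word
    by (metis is_narayana_fixed_point_def shift.simps stream.collapse)
  then show ?case by auto
next
  case (Suc n)
  then obtain s where "narayana_word = narayana_prefix n @- s" by blast
  then have "flat (smap narayana_morphism narayana_word) =
      narayana_prefix (Suc n) @- flat (smap narayana_morphism s)"
    using flat_smap_morphism_shift[of "narayana_prefix n" s] morphism_narayana_prefix[of n] by metis
  then show ?case
    using is_narayana_fixed_point_narayana_word unfolding is_narayana_fixed_point_def by metis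
qed

lemma narayana_word_nth: "j < narayana n \<Longrightarrow> narayana_word !! j = narayana_prefix n ! j"
  using narayana_word_eq_prefix_shift[of n] by (metis length_narayana_prefix shift_snth_less)

lemma narayana_word_nth_narayana: "narayana_word !! (narayana n - 1) = n mod 3"
  using narayana_word_nth[of "narayana n - 1" n] narayana_pos[of n]
    last_conv_nth[of "narayana_prefix n"]
  by (simp add: last_narayana_prefix)

lemma narayana_word_nth_add:
  assumes "j < narayana m"
  shows "narayana_word !! (narayana (Suc (Suc m)) + j) = narayana_word !! j"
  using assms narayana_word_nth[of j m]
    narayana_word_nth[of "narayana (Suc (Suc m)) + j" "Suc (Suc (Suc m))"]
  by (simp add: nth_append)

lemma narayana_val_replicate_0 [simp]: "narayana_val (replicate n 0) = 0"
  by (induction n) auto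

lemma narayana_val_pos: "0 < narayana_val (u @ 1 # v)"
  by (induction u) (auto simp: narayana_pos)

text \<open>Leading zeros are allowed because deleting a leading 1 may expose them. The induction is
  on length since that 1 is deleted together with the two zeros forced after it.\<close>

lemma narayana_word_nth_val:
  assumes "narayana_admissible (u @ 1 # replicate n 0)"
  shows "narayana_word !! (narayana_val (u @ 1 # replicate n 0) - 1) = n mod 3"
  using assms
proof (induction "length u" arbitrary: u rule: less_induct)
  case less
  show ?case
  proof (cases u)
    case Nil
    then show ?thesis by (simp add: narayana_word_nth_narayana[simplified])
  next
    case (Cons x u')
    let ?e = "u' @ 1 # replicate n 0"
    have x: "narayana_admissible ?e" "x = 0 \<or> x = Suc 0"
      using less.prems Cons admissible_Cons_cases by auto
    show ?thesis
    proof (cases "x = 0")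
      case True
      then show ?thesis using less.hyps[of u'] x Cons by simp
    next
      case False
      then obtain e' where e': "?e = 0 # 0 # e'"
        using less.prems Cons x(2) admissible_1[of ?e] by (cases u') auto
      \<comment> \<open>Both forced zeros lie inside \<open>u'\<close>, because the letter right
        after \<open>u'\<close> is 1.\<close>
      then obtain v where v: "u' = 0 # 0 # v"
        by (cases u' rule: remdups_adj.cases) auto
      let ?f = "v @ 1 # replicate n 0"
      have f: "narayana_admissible ?f" using x v by simp
      have pos: "0 < narayana_val ?f" by (rule narayana_val_pos)
      have bound: "narayana_val ?f - 1 < narayana (length ?f)"
        using narayana_val_less[OF f] by simp
      \<comment> \<open>The deleted 1 has weight \<open>narayana (length ?f + 2)\<close>. Positivity
        of \<open>narayana_val ?f\<close> lets the truncated subtraction, which shifts to indexing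
        from 0, move onto that summand.\<close>
      have "narayana_val (u @ 1 # replicate n 0) - 1 =
          narayana (Suc (Suc (length ?f))) + (narayana_val ?f - 1)"
        using Cons v False x(2) pos by simp
      then show ?thesis
        using narayana_word_nth_add[OF bound] less.hyps[of v] f Cons v by simp
    qed
  qed
qed

lemma narayana_rep_decompose:
  assumes "0 < k"
  obtains u n where "narayana_rep k = u @ 1 # replicate n 0"
proof -
  have rep: "is_narayana_rep (narayana_rep k) k"
    using assms by (rule is_narayana_rep_narayana_rep)
  then have "1 \<in> set (narayana_rep k)" and sub: "set (narayana_rep k) \<subseteq> {0, 1}"
    unfolding is_narayana_rep_def by (metis hd_in_set, blast)
  then obtain u v where uv: "narayana_rep k = u @ 1 # v" "1 \<notin> set v"
    using split_list_last by metis
  then have "set v \<subseteq> {0}" using sub by auto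
  then have "v = replicate (length v) 0"
    by (intro replicate_eqI) auto
  then show ?thesis using that uv by metis
qed

theorem theorem23:
  fixes i k :: nat
  assumes "i \<in> {0, 1, 2}" and "k > 0"
  shows "narayana_word !! (k - 1) = i \<longleftrightarrow>
    (\<exists>s u. narayana_rep k = u @ [1] @ replicate (3 * s + i) 0)"
proof -
  have "narayana_admissible (narayana_rep k)" "narayana_val (narayana_rep k) = k"
    using is_narayana_rep_narayana_rep[OF assms(2)] by (auto simp: is_narayana_rep_iff)
  then have letter: "narayana_word !! (k - 1) = n mod 3"
    if "narayana_rep k = u @ 1 # replicate n 0" for u n
    using narayana_word_nth_val[of u n] that by simp
  show ?thesis
  proof
    assume i: "narayana_word !! (k - 1) = i"
    obtain u n where un: "narayana_rep k = u @ 1 # replicate n 0"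
      using narayana_rep_decompose[OF assms(2)] .
    \<comment> \<open>The witness for s is \<open>n div 3\<close>.\<close>
    then have "n = 3 * (n div 3) + i"
      using letter i by (metis mult_div_mod_eq)
    then show "\<exists>s u. narayana_rep k = u @ [1] @ replicate (3 * s + i) 0"
      using un by (metis append_Cons append_Nil)
  next
    assume "\<exists>s u. narayana_rep k = u @ [1] @ replicate (3 * s + i) 0"
    then show "narayana_word !! (k - 1) = i"
      using letter assms(1) by (elim exE) auto
  qed
qed

end
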